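(* Let $\alpha \ge 0$ and $\beta \ge 0$ be real numbers, and let $\pi$ be a (possibly improper) scale mixture prior density on $\mathbb{R}$ satisfying $\pi(\theta) \sim |\theta|^{-\alpha}(-\log|\theta|)^{\beta}$ as $\theta \to 0$. Then: (i) $\pi$ is normalisable near the origin if and only if $\alpha < 1$. (ii) If $\alpha < 1$, then (for every $\beta \ge 0$) the near-zero contribution to the second moment is also finite: $\int_0^{\varepsilon} \theta^2 \pi(\theta)\, d\theta < \infty$ for all sufficiently small $\varepsilon > 0$. In particular, the horseshoe density $\pi_H$ (which is the case $\alpha = 0$, $\beta = 1$) is normalisable near the origin with finite near-zero second moment, i.e. $\int_0^{\varepsilon} \pi_H(\theta)\, d\theta < \infty$ and $\int_0^{\varepsilon} \theta^2 \pi_H(\theta)\, d\theta < \infty$ for all sufficiently small $\varepsilon > 0$; while a scale mixture prior with power-law pole $\pi(\theta) \sim |\theta|^{-\alpha}$ as $\theta \to 0$ with $\alpha \ge 1$ is not normalisable near the origin.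
   Context: A scale mixture prior (of normals) is a function $\pi(\theta) = \int_0^\infty \frac{1}{\sqrt{2\pi}\,\lambda} \exp\!\left(-\frac{\theta^2}{2\lambda^2}\right) g(\lambda)\, d\lambda$ for a nonnegative measurable mixing function $g$ on $(0,\infty)$; it is symmetric in $\theta$, and it is allowed to be improper (not integrable), since normalisability is what is being characterised. (Inside the normal density the symbol $\pi$ denotes the usual constant.) "Normalisable near the origin" means $\int_0^{\varepsilon} \pi(\theta)\, d\theta < \infty$ for all sufficiently small $\varepsilon > 0$. The notation $\pi(\theta) \sim f(\theta)$ as $\theta \to 0$ means asymptotic equivalence up to a positive multiplicative constant: $\lim_{\theta \to 0} \pi(\theta)/f(\theta)$ exists and lies in $(0,\infty)$. The horseshoe density (with global scale equal to $1$) is the scale mixture obtained by taking $g$ to be the standard half-Cauchy density, $g(\lambda) = \frac{2}{\pi(1+\lambda^2)}$ for $\lambda > 0$, that is, for $\theta \ne 0$, $$\pi_H(\theta) = \int_0^\infty \frac{1}{\sqrt{2\pi}\,\lambda} \exp\!\left(-\frac{\theta^2}{2\lambda^2}\right) \frac{2}{\pi(1+\lambda^2)}\, d\lambda .$$ *)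

theory Defs
  imports "HOL-Probability.Probability"
begin

text \<open>
  The mixing function need not be integrable, so the mixture is taken in the extended nonnegative
  reals: it may be improper, and it may be infinite at individual points (as the horseshoe is at 0).
\<close>

definition scale_mixture :: "(real \<Rightarrow> real) \<Rightarrow> real \<Rightarrow> ennreal" where
  "scale_mixture g \<theta> =
     (\<integral>\<^sup>+ \<sigma> \<in> {0<..}. ennreal (normal_density 0 \<sigma> \<theta> * g \<sigma>) \<partial>lebesgue)"

definition scale_mixture_prior :: "(real \<Rightarrow> ennreal) \<Rightarrow> bool" where
  "scale_mixture_prior p \<longleftrightarrow>
     (\<exists>g. g \<in> borel_measurable (lebesgue_on {0<..}) \<and> (\<forall>\<sigma>>0. 0 \<le> g \<sigma>) \<and> p = scale_mixture g)"

definition horseshoe :: "real \<Rightarrow> ennreal" where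
  "horseshoe = scale_mixture (\<lambda>\<sigma>. 2 / (pi * (1 + \<sigma>\<^sup>2)))"

text \<open>
  Equivalence up to a positive constant, in contrast to the library relation \<open>\<sim>[F]\<close>, whose limit
  must be 1. The filter \<open>at 0\<close> is two-sided and excludes the point 0.
\<close>

definition asymp_const_at_0 :: "(real \<Rightarrow> ennreal) \<Rightarrow> (real \<Rightarrow> real) \<Rightarrow> bool" where
  "asymp_const_at_0 p f \<longleftrightarrow>
     (\<exists>c::real. 0 < c \<and> ((\<lambda>\<theta>. p \<theta> / ennreal (f \<theta>)) \<longlongrightarrow> ennreal c) (at 0))"

definition normalisable_near_0 :: "(real \<Rightarrow> ennreal) \<Rightarrow> bool" where
  "normalisable_near_0 p \<longleftrightarrow>
     (\<forall>\<^sub>F \<epsilon> in at_right 0. (\<integral>\<^sup>+ \<theta> \<in> {0<..<\<epsilon>}. p \<theta> \<partial>lebesgue) < \<infinity>)"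

definition finite_second_moment_near_0 :: "(real \<Rightarrow> ennreal) \<Rightarrow> bool" where
  "finite_second_moment_near_0 p \<longleftrightarrow>
     (\<forall>\<^sub>F \<epsilon> in at_right 0. (\<integral>\<^sup>+ \<theta> \<in> {0<..<\<epsilon>}. ennreal (\<theta>\<^sup>2) * p \<theta> \<partial>lebesgue) < \<infinity>)"

end

theory Submission
  imports Defs "HOL-Real_Asymp.Real_Asymp"
begin

text \<open>
  Near 0 the density lies between two positive multiples of
  \<open>f \<theta> = \<theta> powr (- \<alpha>) * (- ln \<theta>) powr \<beta>\<close>. The logarithmic factor is absorbed by an arbitrarily small
  power, so for \<open>\<alpha> < 1\<close> the function \<open>f\<close> is dominated by \<open>\<theta> powr (- \<gamma>)\<close> with some \<open>\<gamma> < 1\<close>, while for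
  \<open>1 \<le> \<alpha>\<close> it dominates \<open>1 / \<theta>\<close>. For the horseshoe, the mixing scales between
  \<open>\<bar>\<theta>\<bar>\<close> and 1 contribute a constant multiple of \<open>- ln \<bar>\<theta>\<bar>\<close> up to a bounded error, and the other
  scales a bounded amount.
\<close>

section \<open>Two-sided comparison and model integrals near 0\<close>

text \<open>The limit \<open>c\<close> of the ratio lies strictly between \<open>c / 2\<close> and
  \<open>2 * c\<close>, so the ratio eventually does too; multiplying back by \<open>f\<close> turns
  this into bounds on \<open>p\<close>.\<close>

lemma asymp_const_at_0_bounds:
  assumes "asymp_const_at_0 p f" and f: "\<forall>\<^sub>F \<theta> in at_right 0. 0 < f \<theta>"
  obtains a b where "0 < a" "0 < b"
    "\<forall>\<^sub>F \<theta> in at_right 0. ennreal (a * f \<theta>) \<le> p \<theta> \<and> p \<theta> \<le> ennreal (b * f \<theta>)"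
proof -
  obtain c where c: "0 < c" "((\<lambda>\<theta>. p \<theta> / ennreal (f \<theta>)) \<longlongrightarrow> ennreal c) (at 0)"
    using assms(1) unfolding asymp_const_at_0_def by blast
  have lim: "((\<lambda>\<theta>. p \<theta> / ennreal (f \<theta>)) \<longlongrightarrow> ennreal c) (at_right 0)"
    using c(2) filterlim_at_split by blast
  have "\<forall>\<^sub>F \<theta> in at_right 0. ennreal (c / 2) < p \<theta> / ennreal (f \<theta>)"
    using c(1) by (intro order_tendstoD(1)[OF lim] ennreal_lessI) auto
  moreover have "\<forall>\<^sub>F \<theta> in at_right 0. p \<theta> / ennreal (f \<theta>) < ennreal (2 * c)"
    using c(1) by (intro order_tendstoD(2)[OF lim] ennreal_lessI) auto
  ultimately have "\<forall>\<^sub>F \<theta> in at_right 0. ennreal (c / 2 * f \<theta>) \<le> p \<theta> \<and> p \<theta> \<le> ennreal (2 * c * f \<theta>)"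
    using f
  proof eventually_elim
    case (elim \<theta>)
    \<comment> \<open>Dividing by \<open>f\<close> and multiplying back is harmless in
      \<open>ennreal\<close> because \<open>ennreal (f \<theta>)\<close> is neither 0 nor
      infinite.\<close>
    have eq: "p \<theta> / ennreal (f \<theta>) * ennreal (f \<theta>) = p \<theta>"
      using elim(3) by (simp add: ennreal_divide_times ennreal_times_divide mult_divide_eq_ennreal)
    have "ennreal (c / 2) * ennreal (f \<theta>) \<le> p \<theta>" "p \<theta> \<le> ennreal (2 * c) * ennreal (f \<theta>)"
      using mult_right_mono[OF less_imp_le[OF elim(1)], of "ennreal (f \<theta>)"]
        mult_right_mono[OF less_imp_le[OF elim(2)], of "ennreal (f \<theta>)"]
      by (simp_all add: eq)
    then show ?case
      using c(1) elim(3) by (simp add: ennreal_mult[symmetric])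
  qed
  then show ?thesis
    using c(1) by (intro that[of "c / 2" "2 * c"]) auto
qed

lemma nn_integral_powr_near_0_finite:
  assumes "\<gamma> < 1" "0 \<le> C" "0 < \<epsilon>"
  shows "(\<integral>\<^sup>+ \<theta> \<in> {0<..<\<epsilon>}. ennreal (C * \<theta> powr (- \<gamma>)) \<partial>lebesgue) < \<infinity>"
proof -
  have "((\<lambda>\<theta>. C * \<theta> powr (- \<gamma>)) has_integral (C * (\<epsilon> powr (1 - \<gamma>) / (1 - \<gamma>)))) {0..\<epsilon>}"
    using has_integral_mult_right[OF has_integral_powr_from_0[of "- \<gamma>" \<epsilon>], of C] assms by simp
  then have "(\<integral>\<^sup>+ \<theta>. ennreal (indicator {0..\<epsilon>} \<theta> * (C * \<theta> powr (- \<gamma>))) \<partial>lborel) < \<infinity>"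
    using nn_integral_has_integral_lebesgue[of "{0..\<epsilon>}" "\<lambda>\<theta>. C * \<theta> powr (- \<gamma>)"] assms(2) by simp
  moreover have "(\<integral>\<^sup>+ \<theta> \<in> {0<..<\<epsilon>}. ennreal (C * \<theta> powr (- \<gamma>)) \<partial>lborel)
      \<le> (\<integral>\<^sup>+ \<theta>. ennreal (indicator {0..\<epsilon>} \<theta> * (C * \<theta> powr (- \<gamma>))) \<partial>lborel)"
    by (intro nn_integral_mono) (auto simp: indicator_def)
  ultimately show ?thesis
    by (simp add: nn_integral_completion)
qed

lemma nn_integral_inverse_Icc:
  assumes "0 < a" "a \<le> b"
  shows "(\<integral>\<^sup>+ x \<in> {a..b}. ennreal (1 / x) \<partial>lborel) = ennreal (ln b - ln a)"
  by (rule nn_integral_FTC_Icc) (use assms in \<open>auto intro!: derivative_eq_intros\<close>)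

text \<open>The interval from \<open>b * exp (- M)\<close> to \<open>b\<close> already carries mass
  exactly \<open>M\<close>, and \<open>M\<close> is arbitrary.\<close>

lemma nn_integral_inverse_near_0:
  assumes "0 < \<epsilon>"
  shows "(\<integral>\<^sup>+ \<theta> \<in> {0<..<\<epsilon>}. ennreal (1 / \<theta>) \<partial>lebesgue) = \<infinity>"
proof -
  let ?I = "\<integral>\<^sup>+ \<theta> \<in> {0<..<\<epsilon>}. ennreal (1 / \<theta>) \<partial>lborel"
  have *: "ennreal M \<le> ?I" if "0 \<le> M" for M
  proof -
    \<comment> \<open>Half of \<epsilon> keeps the closed interval \<open>{b * exp (- M)..b}\<close>
      inside the open one.\<close>
    define b where "b = \<epsilon> / 2"
    have b: "0 < b" "b < \<epsilon>" using assms by (auto simp: b_def)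
    have "ennreal M = (\<integral>\<^sup>+ x \<in> {b * exp (- M)..b}. ennreal (1 / x) \<partial>lborel)"
      using that b by (subst nn_integral_inverse_Icc) (auto simp: ln_mult)
    also have "\<dots> \<le> ?I"
    proof (rule nn_integral_mono)
      fix x :: real
      have "0 < b * exp (- M)" using b(1) by simp
      then have "0 < x" if "b * exp (- M) \<le> x" using that by linarith
      with b show "ennreal (1 / x) * indicator {b * exp (- M)..b} x \<le> ennreal (1 / x) * indicator {0<..<\<epsilon>} x"
        by (auto simp: indicator_def)
    qed
    finally show ?thesis .
  qed
  have "?I = top"
  proof (cases ?I rule: ennreal_cases)
    case (real r)
    with *[of "r + 1"] show ?thesis by simp
  qed
  then show ?thesis
    by (simp add: nn_integral_completion)
qed

section \<open>Normalisability criteria from pointwise bounds\<close>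

lemma normalisable_near_0_powr_bound:
  assumes "\<gamma> < 1" "0 \<le> C" and bound: "\<forall>\<^sub>F \<theta> in at_right 0. p \<theta> \<le> ennreal (C * \<theta> powr (- \<gamma>))"
  shows "normalisable_near_0 p"
proof -
  obtain d where d: "0 < d" "\<And>\<theta>. 0 < \<theta> \<Longrightarrow> \<theta> < d \<Longrightarrow> p \<theta> \<le> ennreal (C * \<theta> powr (- \<gamma>))"
    using bound by (auto simp: eventually_at_right_field)
  have "(\<integral>\<^sup>+ \<theta> \<in> {0<..<\<epsilon>}. p \<theta> \<partial>lebesgue) < \<infinity>" if "0 < \<epsilon>" "\<epsilon> < d" for \<epsilon>
  proof -
    have "(\<integral>\<^sup>+ \<theta> \<in> {0<..<\<epsilon>}. p \<theta> \<partial>lebesgue)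
        \<le> (\<integral>\<^sup>+ \<theta> \<in> {0<..<\<epsilon>}. ennreal (C * \<theta> powr (- \<gamma>)) \<partial>lebesgue)"
      using d(2) that by (intro nn_integral_mono) (auto simp: indicator_def)
    also have "\<dots> < \<infinity>"
      by (rule nn_integral_powr_near_0_finite) fact+
    finally show ?thesis .
  qed
  then show ?thesis
    unfolding normalisable_near_0_def eventually_at_right_field using d(1) by blast
qed

text \<open>On (0, 1) the weight \<open>\<theta>\<^sup>2\<close> is at most 1, so the second-moment
  integrand is dominated by \<open>p\<close> itself.\<close>

lemma finite_second_moment_near_0_if_normalisable:
  assumes "normalisable_near_0 p"
  shows "finite_second_moment_near_0 p"
proof -
  have "\<forall>\<^sub>F \<epsilon> in at_right (0::real). \<epsilon> < 1"
    by real_asymp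
  with assms show ?thesis
    unfolding finite_second_moment_near_0_def normalisable_near_0_def
  proof eventually_elim
    case (elim \<epsilon>)
    have "ennreal (\<theta>\<^sup>2) * p \<theta> \<le> p \<theta>" if "0 < \<theta>" "\<theta> < \<epsilon>" for \<theta>
      using mult_right_mono[of "ennreal (\<theta>\<^sup>2)" 1 "p \<theta>"] that elim(2)
      by (simp add: power_le_one)
    then have "(\<integral>\<^sup>+ \<theta> \<in> {0<..<\<epsilon>}. ennreal (\<theta>\<^sup>2) * p \<theta> \<partial>lebesgue)
        \<le> (\<integral>\<^sup>+ \<theta> \<in> {0<..<\<epsilon>}. p \<theta> \<partial>lebesgue)"
      by (intro nn_integral_mono) (auto simp: indicator_def)
    with elim(1) show ?case by (rule le_less_trans[rotated])
  qed
qed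

lemma not_normalisable_near_0_inverse_bound:
  assumes "0 < a" and bound: "\<forall>\<^sub>F \<theta> in at_right 0. ennreal (a * (1 / \<theta>)) \<le> p \<theta>"
  shows "\<not> normalisable_near_0 p"
proof
  assume p: "normalisable_near_0 p"
  obtain d where d: "0 < d" "\<And>\<theta>. 0 < \<theta> \<Longrightarrow> \<theta> < d \<Longrightarrow> ennreal (a * (1 / \<theta>)) \<le> p \<theta>"
    using bound by (auto simp: eventually_at_right_field)
  have "\<forall>\<^sub>F \<epsilon> in at_right 0. 0 < \<epsilon> \<and> \<epsilon> < d"
    unfolding eventually_at_right_field using d(1) by auto
  \<comment> \<open>Normalisability concerns all small \<epsilon>, but a contradiction needs just
    one that is also below \<open>d\<close>; it exists because the filter \<open>at_right 0\<close>
    is nontrivial.\<close>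
  then have "\<forall>\<^sub>F \<epsilon> in at_right 0. (0 < \<epsilon> \<and> \<epsilon> < d) \<and> (\<integral>\<^sup>+ \<theta> \<in> {0<..<\<epsilon>}. p \<theta> \<partial>lebesgue) < \<infinity>"
    using p unfolding normalisable_near_0_def by (rule eventually_conj)
  then obtain \<epsilon> where \<epsilon>: "0 < \<epsilon>" "\<epsilon> < d" "(\<integral>\<^sup>+ \<theta> \<in> {0<..<\<epsilon>}. p \<theta> \<partial>lebesgue) < \<infinity>"
    using eventually_happens trivial_limit_at_right_real by blast
  have "\<infinity> = ennreal a * (\<integral>\<^sup>+ \<theta> \<in> {0<..<\<epsilon>}. ennreal (1 / \<theta>) \<partial>lebesgue)"
    using assms(1) \<epsilon>(1) by (simp add: nn_integral_inverse_near_0 ennreal_mult_top)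
  also have "\<dots> = (\<integral>\<^sup>+ \<theta>. ennreal a * (ennreal (1 / \<theta>) * indicator {0<..<\<epsilon>} \<theta>) \<partial>lebesgue)"
    by (simp add: nn_integral_completion nn_integral_cmult)
  also have "\<dots> \<le> (\<integral>\<^sup>+ \<theta> \<in> {0<..<\<epsilon>}. p \<theta> \<partial>lebesgue)"
    using d(2) \<epsilon>(2) assms(1) by (intro nn_integral_mono) (auto simp: indicator_def ennreal_mult[symmetric])
  finally show False
    using \<epsilon>(3) by simp
qed

section \<open>The dichotomy for poles with a logarithmic factor\<close>

lemma log_pole_normalisable_iff:
  assumes "0 \<le> \<alpha>" "0 \<le> \<beta>"
    and p: "asymp_const_at_0 p (\<lambda>\<theta>. \<bar>\<theta>\<bar> powr (- \<alpha>) * (- ln \<bar>\<theta>\<bar>) powr \<beta>)"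
  shows "normalisable_near_0 p \<longleftrightarrow> \<alpha> < 1"
proof -
  let ?f = "\<lambda>\<theta>::real. \<bar>\<theta>\<bar> powr (- \<alpha>) * (- ln \<bar>\<theta>\<bar>) powr \<beta>"
  \<comment> \<open>Below \<open>exp (- 1)\<close> one has \<open>- ln \<theta> > 1\<close>, which
    makes the logarithmic factor positive and, as \<beta> is nonnegative, at least 1.\<close>
  have small: "\<forall>\<^sub>F \<theta> in at_right (0::real). 0 < \<theta> \<and> \<theta> < exp (- 1)"
    unfolding eventually_at_right_field by (rule exI[of _ "exp (- 1)"]) auto
  then have "\<forall>\<^sub>F \<theta> in at_right 0. 0 < ?f \<theta>"
  proof eventually_elim
    case (elim \<theta>)
    then have "\<theta> < 1" using less_trans[of \<theta> "exp (- 1)" 1] by simp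
    with elim show ?case by simp
  qed
  with p obtain a b where ab: "0 < a" "0 < b"
    "\<forall>\<^sub>F \<theta> in at_right 0. ennreal (a * ?f \<theta>) \<le> p \<theta> \<and> p \<theta> \<le> ennreal (b * ?f \<theta>)"
    by (rule asymp_const_at_0_bounds)
  have "normalisable_near_0 p" if "\<alpha> < 1"
  proof (rule normalisable_near_0_powr_bound)
    \<comment> \<open>Half the gap between \<alpha> and 1: the exponent \<alpha> + \<delta> stays
      below 1, while the spare power \<open>\<theta> powr \<delta>\<close> still beats every power
      of the logarithm.\<close>
    define \<delta> where "\<delta> = (1 - \<alpha>) / 2"
    have "0 < \<delta>" using that by (simp add: \<delta>_def)
    then have "((\<lambda>\<theta>::real. (- ln \<theta>) powr \<beta> * \<theta> powr \<delta>) \<longlongrightarrow> 0) (at_right 0)"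
      by real_asymp
    then have "\<forall>\<^sub>F \<theta> in at_right (0::real). (- ln \<theta>) powr \<beta> * \<theta> powr \<delta> < 1"
      by (rule order_tendstoD) simp
    with ab(3) small show "\<forall>\<^sub>F \<theta> in at_right 0. p \<theta> \<le> ennreal (b * \<theta> powr (- (\<alpha> + \<delta>)))"
    proof eventually_elim
      case (elim \<theta>)
      have "?f \<theta> = \<theta> powr (- (\<alpha> + \<delta>)) * ((- ln \<theta>) powr \<beta> * \<theta> powr \<delta>)"
        using elim(2) by (simp add: powr_add[symmetric] mult_ac)
      also have "\<dots> \<le> \<theta> powr (- (\<alpha> + \<delta>)) * 1"
        using elim(3) by (intro mult_left_mono) auto
      finally have "ennreal (b * ?f \<theta>) \<le> ennreal (b * \<theta> powr (- (\<alpha> + \<delta>)))"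
        using ab(2) by (intro ennreal_leI mult_left_mono) auto
      with elim(1) show ?case by (metis order.trans)
    qed
    show "\<alpha> + \<delta> < 1" using that by (simp add: \<delta>_def field_simps)
  qed (use ab(2) in simp)
  moreover have "\<not> normalisable_near_0 p" if "1 \<le> \<alpha>"
  proof (rule not_normalisable_near_0_inverse_bound)
    show "\<forall>\<^sub>F \<theta> in at_right 0. ennreal (a * (1 / \<theta>)) \<le> p \<theta>"
      using ab(3) small
    proof eventually_elim
      case (elim \<theta>)
      then have "\<theta> < 1" using less_trans[of \<theta> "exp (- 1)" 1] by simp
      have "ln \<theta> < ln (exp (- 1))" using elim(2) by (intro ln_less_cancel_iff[THEN iffD2]) auto
      then have "1 \<le> (- ln \<theta>) powr \<beta>" using assms(2) by (intro ge_one_powr_ge_zero) auto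
      \<comment> \<open>For \<theta> < 1 a more negative exponent gives a larger power, so the pole
        of order \<alpha> dominates that of order 1.\<close>
      moreover have "\<theta> powr (- 1) \<le> \<theta> powr (- \<alpha>)"
        using elim(2) \<open>\<theta> < 1\<close> that by (intro powr_mono') auto
      ultimately have "\<theta> powr (- 1) * 1 \<le> ?f \<theta>"
        using elim(2) by (intro mult_mono) auto
      then have "ennreal (a * (1 / \<theta>)) \<le> ennreal (a * ?f \<theta>)"
        using ab(1) elim(2) by (intro ennreal_leI mult_left_mono) (auto simp: powr_minus_divide)
      with elim(1) show ?case by (metis order.trans)
    qed
  qed fact
  ultimately show ?thesis by force
qed

section \<open>Bounds for the horseshoe mixture integral\<close>

text \<open>The prefactor collects \<open>1 / sqrt (2 * pi)\<close> from the normal density and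
  \<open>2 / pi\<close> from the half-Cauchy density, leaving a kernel that depends on \<theta> only
  through its square.\<close>

lemma horseshoe_eq:
  "horseshoe \<theta> = ennreal (2 / (pi * sqrt (2 * pi))) *
     (\<integral>\<^sup>+ \<sigma> \<in> {0<..}. ennreal (exp (- (\<theta>\<^sup>2 / (2 * \<sigma>\<^sup>2))) / (\<sigma> * (1 + \<sigma>\<^sup>2))) \<partial>lborel)"
proof -
  have "horseshoe \<theta> = (\<integral>\<^sup>+ \<sigma>. ennreal (2 / (pi * sqrt (2 * pi))) *
     (ennreal (exp (- (\<theta>\<^sup>2 / (2 * \<sigma>\<^sup>2))) / (\<sigma> * (1 + \<sigma>\<^sup>2))) * indicator {0<..} \<sigma>) \<partial>lborel)"
    unfolding horseshoe_def scale_mixture_def nn_integral_completion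
  proof (intro nn_integral_cong)
    fix \<sigma> :: real
    have "normal_density 0 \<sigma> \<theta> * (2 / (pi * (1 + \<sigma>\<^sup>2))) =
      2 / (pi * sqrt (2 * pi)) * (exp (- (\<theta>\<^sup>2 / (2 * \<sigma>\<^sup>2))) / (\<sigma> * (1 + \<sigma>\<^sup>2)))" if "0 < \<sigma>"
      using that by (simp add: normal_density_def real_sqrt_mult mult_ac)
    then show "ennreal (normal_density 0 \<sigma> \<theta> * (2 / (pi * (1 + \<sigma>\<^sup>2)))) * indicator {0<..} \<sigma> =
      ennreal (2 / (pi * sqrt (2 * pi))) *
      (ennreal (exp (- (\<theta>\<^sup>2 / (2 * \<sigma>\<^sup>2))) / (\<sigma> * (1 + \<sigma>\<^sup>2))) * indicator {0<..} \<sigma>)"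
      by (auto simp: indicator_def ennreal_mult[symmetric])
  qed
  then show ?thesis
    by (simp add: nn_integral_cmult)
qed

text \<open>One bound for each range of scales. For \<sigma> \<le> t the exponential decay is used;
  for t \<le> \<sigma> \<le> 1 both the exponential and \<open>1 + \<sigma>\<^sup>2\<close> are
  dropped; for 1 \<le> \<sigma> the cubic growth of the denominator is kept.\<close>

lemma horseshoe_kernel_le:
  fixes t \<sigma> :: real
  assumes "0 < t" "t < 1" "0 < \<sigma>"
  defines "k \<equiv> exp (- (t\<^sup>2 / (2 * \<sigma>\<^sup>2))) / (\<sigma> * (1 + \<sigma>\<^sup>2))"
  shows "k \<le> 2 * \<sigma> / t\<^sup>2" "k \<le> 1 / \<sigma>" "k \<le> 1 / \<sigma> ^ 3"
proof -
  \<comment> \<open>This is x \<le> exp x at \<open>x = t\<^sup>2 / (2 * \<sigma>\<^sup>2)\<close>;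
    taking reciprocals gives exp (- x) \<le> 1 / x.\<close>
  have "t\<^sup>2 / (2 * \<sigma>\<^sup>2) \<le> exp (t\<^sup>2 / (2 * \<sigma>\<^sup>2))"
    using exp_ge_add_one_self[of "t\<^sup>2 / (2 * \<sigma>\<^sup>2)"] by linarith
  then have e: "exp (- (t\<^sup>2 / (2 * \<sigma>\<^sup>2))) \<le> 2 * \<sigma>\<^sup>2 / t\<^sup>2"
    using assms by (simp add: exp_minus field_simps)
  have "k \<le> (2 * \<sigma>\<^sup>2 / t\<^sup>2) / (\<sigma> * 1)"
    unfolding k_def using assms e by (intro frac_le mult_left_mono) auto
  then show "k \<le> 2 * \<sigma> / t\<^sup>2"
    using assms by (simp add: power2_eq_square)
  show "k \<le> 1 / \<sigma>"
    unfolding k_def using assms by (intro frac_le) auto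
  show "k \<le> 1 / \<sigma> ^ 3"
    unfolding k_def using assms by (intro frac_le) (auto simp: power3_eq_cube power2_eq_square algebra_simps)
qed

text \<open>Splitting the scales at \<open>t\<close> and 1, the three kernel bounds integrate to 1,
  \<open>- ln t\<close> and 1 / 2. Only the middle range grows as \<open>t\<close> tends to
  0.\<close>

lemma horseshoe_kernel_integral_le:
  fixes t :: real
  assumes t: "0 < t" "t < 1"
  shows "(\<integral>\<^sup>+ \<sigma> \<in> {0<..}. ennreal (exp (- (t\<^sup>2 / (2 * \<sigma>\<^sup>2))) / (\<sigma> * (1 + \<sigma>\<^sup>2))) \<partial>lborel)
    \<le> ennreal (- ln t + 3 / 2)"
proof -
  let ?k = "\<lambda>\<sigma>. exp (- (t\<^sup>2 / (2 * \<sigma>\<^sup>2))) / (\<sigma> * (1 + \<sigma>\<^sup>2))"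
  have 1: "(\<integral>\<^sup>+ \<sigma> \<in> {0..t}. ennreal (2 * \<sigma> / t\<^sup>2) \<partial>lborel) = ennreal 1"
    by (subst nn_integral_FTC_Icc[where F = "\<lambda>\<sigma>. \<sigma>\<^sup>2 / t\<^sup>2"])
      (use t in \<open>auto intro!: derivative_eq_intros simp: power2_eq_square\<close>)
  have 2: "(\<integral>\<^sup>+ \<sigma> \<in> {t..1}. ennreal (1 / \<sigma>) \<partial>lborel) = ennreal (- ln t)"
    using t by (subst nn_integral_inverse_Icc) auto
  have 3: "(\<integral>\<^sup>+ \<sigma> \<in> {1..}. ennreal (1 / \<sigma> ^ 3) \<partial>lborel) = ennreal (0 - (- 1 / (2 * 1\<^sup>2)))"
  proof (rule nn_integral_FTC_atLeast[where F = "\<lambda>\<sigma>. - 1 / (2 * \<sigma>\<^sup>2)"])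
    show "((\<lambda>\<sigma>::real. - 1 / (2 * \<sigma>\<^sup>2)) \<longlongrightarrow> 0) at_top" by real_asymp
    show "((\<lambda>\<sigma>. - 1 / (2 * \<sigma>\<^sup>2)) has_real_derivative 1 / \<sigma> ^ 3) (at \<sigma>)" if "1 \<le> \<sigma>" for \<sigma> :: real
      using that by (auto intro!: derivative_eq_intros simp: field_simps power2_eq_square power3_eq_cube)
  qed auto
  \<comment> \<open>The ranges overlap at \<open>t\<close> and 1, which can only enlarge the
    right-hand side; in each case below one summand suffices and the others are nonnegative.\<close>
  have "(\<integral>\<^sup>+ \<sigma> \<in> {0<..}. ennreal (?k \<sigma>) \<partial>lborel)
    \<le> (\<integral>\<^sup>+ \<sigma>. ennreal (2 * \<sigma> / t\<^sup>2) * indicator {0..t} \<sigma> +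
          (ennreal (1 / \<sigma>) * indicator {t..1} \<sigma> + ennreal (1 / \<sigma> ^ 3) * indicator {1..} \<sigma>) \<partial>lborel)"
  proof (intro nn_integral_mono)
    fix \<sigma> :: real
    consider "\<sigma> \<le> 0" | "0 < \<sigma>" "\<sigma> \<le> t" | "0 < \<sigma>" "t \<le> \<sigma>" "\<sigma> \<le> 1" | "0 < \<sigma>" "1 \<le> \<sigma>" by linarith
    then show "ennreal (?k \<sigma>) * indicator {0<..} \<sigma> \<le> ennreal (2 * \<sigma> / t\<^sup>2) * indicator {0..t} \<sigma> +
          (ennreal (1 / \<sigma>) * indicator {t..1} \<sigma> + ennreal (1 / \<sigma> ^ 3) * indicator {1..} \<sigma>)"
    proof cases
      case 2
      have "ennreal (?k \<sigma>) \<le> ennreal (2 * \<sigma> / t\<^sup>2)"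
        using horseshoe_kernel_le(1)[OF t 2(1)] by (rule ennreal_leI)
      with 2 show ?thesis by (intro add_increasing2) auto
    next
      case 3
      have "ennreal (?k \<sigma>) \<le> ennreal (1 / \<sigma>)"
        using horseshoe_kernel_le(2)[OF t 3(1)] by (rule ennreal_leI)
      with 3 show ?thesis by (intro add_increasing add_increasing2) auto
    next
      case 4
      have "ennreal (?k \<sigma>) \<le> ennreal (1 / \<sigma> ^ 3)"
        using horseshoe_kernel_le(3)[OF t 4(1)] by (rule ennreal_leI)
      with 4 show ?thesis by (intro add_increasing) auto
    qed simp
  qed
  also have "\<dots> = (\<integral>\<^sup>+ \<sigma> \<in> {0..t}. ennreal (2 * \<sigma> / t\<^sup>2) \<partial>lborel) +
      ((\<integral>\<^sup>+ \<sigma> \<in> {t..1}. ennreal (1 / \<sigma>) \<partial>lborel) + (\<integral>\<^sup>+ \<sigma> \<in> {1..}. ennreal (1 / \<sigma> ^ 3) \<partial>lborel))"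
    by (subst nn_integral_add; (subst nn_integral_add)?) auto
  also have "\<dots> = ennreal (1 + (- ln t + 1 / 2))"
  proof -
    have nn: "0 \<le> - ln t + 1 / 2" "0 \<le> - ln t" "(0::real) \<le> 1 / 2"
      using ln_less_zero[OF t] by linarith+
    show ?thesis
      unfolding 1 2 3 ennreal_plus[OF zero_le_one nn(1)] ennreal_plus[OF nn(2,3)] by simp
  qed
  finally show ?thesis by (simp add: algebra_simps)
qed

text \<open>Only the scales between \<open>t\<close> and 1 are kept. There exp (- x) \<ge> 1 - x and
  1 / (1 + y) \<ge> 1 - y bound the kernel below by a function with an elementary
  antiderivative.\<close>

lemma horseshoe_kernel_integral_ge:
  fixes t :: real
  assumes t: "0 < t" "t < 1"
  shows "ennreal (- ln t - 1) \<le>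
    (\<integral>\<^sup>+ \<sigma> \<in> {0<..}. ennreal (exp (- (t\<^sup>2 / (2 * \<sigma>\<^sup>2))) / (\<sigma> * (1 + \<sigma>\<^sup>2))) \<partial>lborel)"
proof -
  let ?k = "\<lambda>\<sigma>. exp (- (t\<^sup>2 / (2 * \<sigma>\<^sup>2))) / (\<sigma> * (1 + \<sigma>\<^sup>2))"
  let ?h = "\<lambda>\<sigma>. (1 - t\<^sup>2 / (2 * \<sigma>\<^sup>2)) * (1 - \<sigma>\<^sup>2) / \<sigma>"
  \<comment> \<open>Termwise antiderivative of \<open>?h\<close> after expanding the product into
    \<open>1 / \<sigma> - \<sigma> - t\<^sup>2 / (2 * \<sigma> ^ 3) + t\<^sup>2 / (2 *
    \<sigma>)\<close>.\<close>
  let ?H = "\<lambda>\<sigma>. ln \<sigma> - \<sigma>\<^sup>2 / 2 + t\<^sup>2 / (4 * \<sigma>\<^sup>2) + t\<^sup>2 / 2 * ln \<sigma>"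
  \<comment> \<open>Nonnegativity of both factors makes \<open>?h\<close> a nonnegative integrand;
    that of the second also lets the two lower bounds be multiplied.\<close>
  have q: "0 \<le> 1 - t\<^sup>2 / (2 * \<sigma>\<^sup>2)" "0 \<le> 1 - \<sigma>\<^sup>2" if "t \<le> \<sigma>" "\<sigma> \<le> 1" for \<sigma>
  proof -
    have "t\<^sup>2 \<le> \<sigma>\<^sup>2" using that t by (intro power_mono) auto
    then have "t\<^sup>2 \<le> 2 * \<sigma>\<^sup>2" using zero_le_power2[of \<sigma>] by linarith
    then show "0 \<le> 1 - t\<^sup>2 / (2 * \<sigma>\<^sup>2)" using that t by simp
    show "0 \<le> 1 - \<sigma>\<^sup>2" using that t by (simp add: power_le_one)
  qed
  have hk: "?h \<sigma> \<le> ?k \<sigma>" if "t \<le> \<sigma>" "\<sigma> \<le> 1" for \<sigma>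
  proof -
    have "(1 - \<sigma>\<^sup>2) * (1 + \<sigma>\<^sup>2) \<le> 1" by (simp add: algebra_simps)
    then have "1 - \<sigma>\<^sup>2 \<le> 1 / (1 + \<sigma>\<^sup>2)"
      by (subst pos_le_divide_eq) (auto intro: add_pos_nonneg)
    moreover have "1 - t\<^sup>2 / (2 * \<sigma>\<^sup>2) \<le> exp (- (t\<^sup>2 / (2 * \<sigma>\<^sup>2)))"
      using exp_ge_add_one_self[of "- (t\<^sup>2 / (2 * \<sigma>\<^sup>2))"] by simp
    ultimately have "(1 - t\<^sup>2 / (2 * \<sigma>\<^sup>2)) * (1 - \<sigma>\<^sup>2) \<le> exp (- (t\<^sup>2 / (2 * \<sigma>\<^sup>2))) * (1 / (1 + \<sigma>\<^sup>2))"
      using q(2)[OF that] by (intro mult_mono) auto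
    then have "?h \<sigma> \<le> exp (- (t\<^sup>2 / (2 * \<sigma>\<^sup>2))) * (1 / (1 + \<sigma>\<^sup>2)) / \<sigma>"
      using that t by (intro divide_right_mono) auto
    then show ?thesis by (simp add: mult.commute)
  qed
  have "t\<^sup>2 / 2 * ln t \<le> 0"
    using t by (intro mult_nonneg_nonpos) auto
  moreover have "?H 1 - ?H t = - ln t - 3 / 4 + 3 / 4 * t\<^sup>2 - t\<^sup>2 / 2 * ln t"
    using t by simp
  ultimately have "- ln t - 1 \<le> ?H 1 - ?H t"
    using zero_le_power2[of t] by linarith
  then have "ennreal (- ln t - 1) \<le> ennreal (?H 1 - ?H t)"
    by (rule ennreal_leI)
  also have "\<dots> = (\<integral>\<^sup>+ \<sigma> \<in> {t..1}. ennreal (?h \<sigma>) \<partial>lborel)"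
  proof (rule nn_integral_FTC_Icc[symmetric, where F = ?H])
    show "(?H has_real_derivative ?h \<sigma>) (at \<sigma>)" if "\<sigma> \<in> {t..1}" for \<sigma>
      using that t by (auto intro!: derivative_eq_intros simp: field_simps power2_eq_square)
    show "0 \<le> ?h \<sigma>" if "\<sigma> \<in> {t..1}" for \<sigma>
      using q[of \<sigma>] that t by auto
  qed (use t in auto)
  also have "\<dots> \<le> (\<integral>\<^sup>+ \<sigma> \<in> {0<..}. ennreal (?k \<sigma>) \<partial>lborel)"
    using hk t by (intro nn_integral_mono) (auto simp: indicator_def intro!: ennreal_leI)
  finally show ?thesis .
qed

section \<open>The logarithmic pole of the horseshoe\<close>

text \<open>With L = - ln \<bar>\<theta>\<bar>, the integral bounds place the density between K (L -
  1) and K (L + 3 / 2). Dividing by L squeezes the ratio to \<open>K\<close>, since L tends to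
  infinity.\<close>

lemma horseshoe_asymp_log:
  "asymp_const_at_0 horseshoe (\<lambda>\<theta>. \<bar>\<theta>\<bar> powr (- 0) * (- ln \<bar>\<theta>\<bar>) powr 1)"
proof -
  define K :: real where "K = 2 / (pi * sqrt (2 * pi))"
  have K: "0 < K" by (simp add: K_def)
  let ?f = "\<lambda>\<theta>::real. \<bar>\<theta>\<bar> powr (- 0) * (- ln \<bar>\<theta>\<bar>) powr 1"
  \<comment> \<open>This radius forces - ln \<bar>\<theta>\<bar> > 1, so the lower bound is
    nonnegative and the \<open>ennreal\<close> quotients reduce to real ones.\<close>
  have small: "\<forall>\<^sub>F \<theta> in at (0::real). \<theta> \<noteq> 0 \<and> \<bar>\<theta>\<bar> < exp (- 1)"
    unfolding eventually_at by (rule exI[of _ "exp (- 1)"]) (auto simp: dist_real_def)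
  have bounds: "\<forall>\<^sub>F \<theta> in at 0.
      ennreal (K * ((- ln \<bar>\<theta>\<bar> - 1) / - ln \<bar>\<theta>\<bar>)) \<le> horseshoe \<theta> / ennreal (?f \<theta>) \<and>
      horseshoe \<theta> / ennreal (?f \<theta>) \<le> ennreal (K * ((- ln \<bar>\<theta>\<bar> + 3 / 2) / - ln \<bar>\<theta>\<bar>))"
    using small
  proof eventually_elim
    case (elim \<theta>)
    define t where "t = \<bar>\<theta>\<bar>"
    have t: "0 < t" "t < exp (- 1)" "t < 1"
      using elim less_trans[of t "exp (- 1)" 1] by (auto simp: t_def)
    have L: "1 < - ln t"
      using t ln_less_cancel_iff[of t "exp (- 1)"] by simp
    have f: "?f \<theta> = - ln t"
      using L t by (simp add: t_def)
    have h: "horseshoe \<theta> = ennreal K *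
        (\<integral>\<^sup>+ \<sigma> \<in> {0<..}. ennreal (exp (- (t\<^sup>2 / (2 * \<sigma>\<^sup>2))) / (\<sigma> * (1 + \<sigma>\<^sup>2))) \<partial>lborel)"
      by (simp add: horseshoe_eq K_def t_def)
    have "ennreal (K * (- ln t - 1)) \<le> horseshoe \<theta>" "horseshoe \<theta> \<le> ennreal (K * (- ln t + 3 / 2))"
      using mult_left_mono[OF horseshoe_kernel_integral_ge[OF t(1,3)], of "ennreal K"]
        mult_left_mono[OF horseshoe_kernel_integral_le[OF t(1,3)], of "ennreal K"] K L
      by (simp_all add: h ennreal_mult[symmetric])
    then have "ennreal (K * (- ln t - 1)) / ennreal (- ln t) \<le> horseshoe \<theta> / ennreal (?f \<theta>)"
      "horseshoe \<theta> / ennreal (?f \<theta>) \<le> ennreal (K * (- ln t + 3 / 2)) / ennreal (- ln t)"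
      unfolding f by (auto intro: divide_right_mono_ennreal)
    then show ?case
      using K L by (simp add: t_def[symmetric] divide_ennreal)
  qed
  \<comment> \<open>The absolute value carries the punctured two-sided neighbourhoods of 0 into
    right-sided ones, so limits in t > 0 transfer to both signs of \<theta>.\<close>
  have abs_lim: "filterlim (abs :: real \<Rightarrow> real) (at_right 0) (at 0)"
    by real_asymp
  have "((\<lambda>t::real. K * ((- ln t - 1) / - ln t)) \<longlongrightarrow> K) (at_right 0)"
    "((\<lambda>t::real. K * ((- ln t + 3 / 2) / - ln t)) \<longlongrightarrow> K) (at_right 0)"
    by real_asymp+
  then have "((\<lambda>\<theta>. ennreal (K * ((- ln \<bar>\<theta>\<bar> - 1) / - ln \<bar>\<theta>\<bar>))) \<longlongrightarrow> ennreal K) (at 0)"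
    "((\<lambda>\<theta>. ennreal (K * ((- ln \<bar>\<theta>\<bar> + 3 / 2) / - ln \<bar>\<theta>\<bar>))) \<longlongrightarrow> ennreal K) (at 0)"
    by (auto intro!: tendsto_ennrealI filterlim_compose[OF _ abs_lim])
  then have "((\<lambda>\<theta>. horseshoe \<theta> / ennreal (?f \<theta>)) \<longlongrightarrow> ennreal K) (at 0)"
    by (rule tendsto_sandwich[rotated 2]) (use bounds in \<open>auto elim: eventually_mono\<close>)
  then show ?thesis
    unfolding asymp_const_at_0_def using K by blast
qed

lemma scale_mixture_prior_horseshoe: "scale_mixture_prior horseshoe"
  unfolding scale_mixture_prior_def horseshoe_def
proof (intro exI conjI)
  have "(\<lambda>\<sigma>::real. 2 / (pi * (1 + \<sigma>\<^sup>2))) \<in> borel_measurable lebesgue"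
    by (rule measurable_completion) simp
  then show "(\<lambda>\<sigma>::real. 2 / (pi * (1 + \<sigma>\<^sup>2))) \<in> borel_measurable (lebesgue_on {0<..})"
    by (rule measurable_restrict_space1)
qed auto

section \<open>Deduction of the final claims\<close>

lemma asymp_const_at_0_cong:
  assumes "\<forall>\<^sub>F \<theta> in at 0. f \<theta> = g \<theta>"
  shows "asymp_const_at_0 p f \<longleftrightarrow> asymp_const_at_0 p g"
proof -
  have "((\<lambda>\<theta>. p \<theta> / ennreal (f \<theta>)) \<longlongrightarrow> l) (at 0) \<longleftrightarrow> ((\<lambda>\<theta>. p \<theta> / ennreal (g \<theta>)) \<longlongrightarrow> l) (at 0)" for l
    using assms by (intro tendsto_cong) (auto elim: eventually_mono)
  then show ?thesis unfolding asymp_const_at_0_def by simp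
qed

theorem proposition4p1:
  "(\<forall>(\<alpha>::real) (\<beta>::real) p.
      0 \<le> \<alpha> \<longrightarrow> 0 \<le> \<beta> \<longrightarrow> scale_mixture_prior p \<longrightarrow>
      asymp_const_at_0 p (\<lambda>\<theta>. \<bar>\<theta>\<bar> powr (- \<alpha>) * (- ln \<bar>\<theta>\<bar>) powr \<beta>) \<longrightarrow>
        (normalisable_near_0 p \<longleftrightarrow> \<alpha> < 1) \<and>
        (\<alpha> < 1 \<longrightarrow> finite_second_moment_near_0 p)) \<and>
   (scale_mixture_prior horseshoe \<and>
      asymp_const_at_0 horseshoe (\<lambda>\<theta>. \<bar>\<theta>\<bar> powr (- 0) * (- ln \<bar>\<theta>\<bar>) powr 1) \<and>
      normalisable_near_0 horseshoe \<and> finite_second_moment_near_0 horseshoe) \<and>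
   (\<forall>(\<alpha>::real) p.
      1 \<le> \<alpha> \<longrightarrow> scale_mixture_prior p \<longrightarrow>
      asymp_const_at_0 p (\<lambda>\<theta>. \<bar>\<theta>\<bar> powr (- \<alpha>)) \<longrightarrow> \<not> normalisable_near_0 p)"
proof (intro conjI allI impI)
  fix \<alpha> \<beta> :: real and p
  assume *: "0 \<le> \<alpha>" "0 \<le> \<beta>" "asymp_const_at_0 p (\<lambda>\<theta>. \<bar>\<theta>\<bar> powr (- \<alpha>) * (- ln \<bar>\<theta>\<bar>) powr \<beta>)"
  show "normalisable_near_0 p \<longleftrightarrow> \<alpha> < 1"
    using * by (rule log_pole_normalisable_iff)
  then show "finite_second_moment_near_0 p" if "\<alpha> < 1"
    using that by (simp add: finite_second_moment_near_0_if_normalisable)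
next
  show n: "normalisable_near_0 horseshoe"
    \<comment> \<open>The instance \<alpha> = 0, \<beta> = 1 of the dichotomy.\<close>
    using log_pole_normalisable_iff[OF _ _ horseshoe_asymp_log] by simp
  then show "finite_second_moment_near_0 horseshoe"
    by (rule finite_second_moment_near_0_if_normalisable)
next
  fix \<alpha> :: real and p
  assume \<alpha>: "1 \<le> \<alpha>" and p: "asymp_const_at_0 p (\<lambda>\<theta>. \<bar>\<theta>\<bar> powr (- \<alpha>))"
  \<comment> \<open>A pure power pole is the case \<beta> = 0. As \<open>0 powr 0\<close> is 0, the
    added factor equals 1 only where the logarithm is nonzero; radius 1 around the excluded point 0
    ensures this.\<close>
  have "\<forall>\<^sub>F \<theta> in at (0::real). \<bar>\<theta>\<bar> powr (- \<alpha>) = \<bar>\<theta>\<bar> powr (- \<alpha>) * (- ln \<bar>\<theta>\<bar>) powr 0"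
    unfolding eventually_at by (rule exI[of _ 1]) (auto simp: dist_real_def)
  then have "asymp_const_at_0 p (\<lambda>\<theta>. \<bar>\<theta>\<bar> powr (- \<alpha>) * (- ln \<bar>\<theta>\<bar>) powr 0)"
    using p by (rule asymp_const_at_0_cong[THEN iffD1])
  then show "\<not> normalisable_near_0 p"
    using \<alpha> log_pole_normalisable_iff[of \<alpha> 0 p] by simp
qed (fact scale_mixture_prior_horseshoe horseshoe_asymp_log)+

end
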